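(* Let $$\overline{\mathrm S}(z,q)=\sum_{n=1}^\infty\frac{q^n(q^{2n+2};q^2)_\infty}{(zq^n;q)_\infty(z^{-1}q^n;q)_\infty}.$$ Then, in $\mathbb{Z}[z,z^{-1}][[q]]$, $$(1+z)(z;q)_\infty(z^{-1};q)_\infty(q;q)_\infty\,\overline{\mathrm S}(z,q)=\sum_{n=0}^\infty\ \sum_{m=-\lfloor n/2\rfloor}^{\lfloor n/2\rfloor}(-1)^{m+n}(1-z^{n-2|m|+1})(1-z^{n-2|m|})\,z^{2|m|-n}\,q^{\frac12(n^2-2m^2)+\frac12n}.$$
   Context: Notation: $(a;q)_\infty=\prod_{k\ge 0}(1-aq^k)$, and $(a;q^2)_\infty=\prod_{k\ge0}(1-aq^{2k})$. $\lfloor x\rfloor$ is the integer part of $x$. $\overline{\mathrm S}(z,q)$ is the generating function of the spt-crank for overpartitions. *)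

theory Defs
  imports
    "HOL-Library.Poly_Mapping"
    "HOL-Computational_Algebra.Formal_Power_Series"
    "HOL-Analysis.Infinite_Products"
begin

text \<open>
  Laurent polynomials in \<open>z\<close> over the integers are the group ring of the additive group
  of the integers, i.e. finitely supported functions with the convolution product, so that
  \<open>laurent fps\<close> is \<open>\<int>[z, z\<^sup>-\<^sup>1][[q]]\<close>, with \<open>fps_X\<close> in the role of \<open>q\<close>.
\<close>

type_synonym laurent = "int \<Rightarrow>\<^sub>0 int"

definition zpow :: "int \<Rightarrow> laurent" where
  "zpow k = Poly_Mapping.single k 1"

text \<open>
  Infinite products and sums are limits in the \<open>q\<close>-adic topology that the library puts on
  formal power series. They are written with \<open>prodinf\<close> and \<open>suminf\<close> because the binder
  notation is also claimed by the finite-support operators of \<^theory>\<open>HOL-Library.Groups_Big_Fun\<close>.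
\<close>

definition qpoch :: "'a::comm_ring_1 fps \<Rightarrow> 'a fps \<Rightarrow> 'a fps" where
  "qpoch a q = prodinf (\<lambda>k. 1 - a * q ^ k)"

text \<open>
  Laurent polynomials carry no \<open>inverse\<close> operation, so reciprocals in \<open>laurent fps\<close> are
  written with \<open>fps_right_inverse\<close>, whose second argument is the inverse of the constant
  coefficient; that coefficient is \<open>1\<close> for the denominators used here, which are therefore
  units (\<open>Sbar_denom_inverse\<close> below).
\<close>

definition Sbar_denom :: "nat \<Rightarrow> laurent fps" where
  "Sbar_denom n =
     qpoch (fps_const (zpow 1) * fps_X ^ n) fps_X *
     qpoch (fps_const (zpow (-1)) * fps_X ^ n) fps_X"

definition Sbar_summand :: "nat \<Rightarrow> laurent fps" where
  "Sbar_summand n =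
     fps_X ^ n * qpoch (fps_X ^ (2 * n + 2)) (fps_X ^ 2) * fps_right_inverse (Sbar_denom n) 1"

text \<open>The sum runs over \<open>n \<ge> 1\<close>, hence the shift by \<open>Suc\<close>.\<close>

definition Sbar :: "laurent fps" where
  "Sbar = suminf (\<lambda>n. Sbar_summand (Suc n))"

text \<open>All products and sums above converge, so none of the limits takes a default value.\<close>

lemma qpoch_aux:
  fixes a q :: "'a::idom fps"
  assumes q: "fps_nth q 0 = 0" and a: "fps_nth a 0 \<noteq> 1"
  shows qpoch_has_prod: "(\<lambda>k. 1 - a * q ^ k) has_prod qpoch a q"
    and qpoch_nth_0: "fps_nth (qpoch a q) 0 = 1 - fps_nth a 0"
proof -
  define P where "P n = (\<Prod>i\<le>n. 1 - a * q ^ i)" for n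
  define L where "L = Abs_fps (\<lambda>k. fps_nth (P k) k)"
  have van: "fps_nth (q ^ n * b) k = 0" if "k < n" for n k and b :: "'a fps"
    using that by (auto simp: fps_mult_nth intro!: sum.neutral startsby_zero_power_prefix[OF q, rule_format])
  have step: "fps_nth (P (Suc n)) k = fps_nth (P n) k" if "k \<le> n" for n k
  proof -
    have "P (Suc n) = P n - q ^ Suc n * (P n * a)"
      by (simp add: P_def algebra_simps)
    then show ?thesis
      using van[of k "Suc n" "P n * a"] that by simp
  qed
  have stable: "fps_nth (P n) k = fps_nth (P k) k" if "k \<le> n" for n k
    using that by (induction n rule: dec_induct) (simp_all add: step)
  have lim: "P \<longlonglongrightarrow> L"
  proof (rule tendsto_fpsI)
    fix k
    show "eventually (\<lambda>n. fps_nth (P n) k = fps_nth L k) sequentially"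
      using eventually_ge_at_top[of k] by eventually_elim (auto simp: L_def intro: stable)
  qed
  have L0: "fps_nth L 0 = 1 - fps_nth a 0"
    by (simp add: L_def P_def)
  then have "L \<noteq> 0"
    using a by auto
  then have "(\<lambda>k. 1 - a * q ^ k) has_prod L"
    using lim by (simp add: has_prod_def raw_has_prod_def P_def[abs_def])
  moreover from this have "qpoch a q = L"
    unfolding qpoch_def using has_prod_unique by metis
  ultimately show "(\<lambda>k. 1 - a * q ^ k) has_prod qpoch a q" "fps_nth (qpoch a q) 0 = 1 - fps_nth a 0"
    using L0 by simp_all
qed

lemma zpow_neq_1: "k \<noteq> 0 \<Longrightarrow> zpow k \<noteq> 1"
  unfolding zpow_def by (metis lookup_single_eq lookup_single_not_eq single_one zero_neq_one)

lemma qpoch_zpow_has_prod: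
  "k \<noteq> 0 \<Longrightarrow> (\<lambda>i. 1 - fps_const (zpow k) * fps_X ^ i) has_prod qpoch (fps_const (zpow k)) fps_X"
  by (rule qpoch_has_prod) (simp_all add: zpow_neq_1)

lemma Sbar_denom_inverse:
  assumes "n \<ge> 1"
  shows "Sbar_denom n * fps_right_inverse (Sbar_denom n) 1 = 1"
proof (rule fps_right_inverse)
  show "fps_nth (Sbar_denom n) 0 * 1 = 1"
    using assms by (simp add: Sbar_denom_def qpoch_nth_0)
qed

lemma fps_summableI:
  fixes f :: "nat \<Rightarrow> 'a::ab_group_add fps"
  assumes "\<And>n k. k < n \<Longrightarrow> fps_nth (f n) k = 0"
  shows "summable f"
proof -
  have "f sums Abs_fps (\<lambda>k. \<Sum>n\<le>k. fps_nth (f n) k)"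
    unfolding sums_def
  proof (rule tendsto_fpsI)
    fix k
    show "eventually (\<lambda>N. fps_nth (\<Sum>n<N. f n) k = fps_nth (Abs_fps (\<lambda>k. \<Sum>n\<le>k. fps_nth (f n) k)) k) sequentially"
      using eventually_gt_at_top[of k]
    proof eventually_elim
      case (elim N)
      have "(\<Sum>n<N. fps_nth (f n) k) = (\<Sum>n\<le>k. fps_nth (f n) k)"
        using elim assms by (intro sum.mono_neutral_right) auto
      then show ?case
        by (simp add: fps_sum_nth)
    qed
  qed
  then show ?thesis
    by (rule sums_summable)
qed

lemma summable_Sbar_summand: "summable (\<lambda>n. Sbar_summand (Suc n))"
  by (rule fps_summableI)
    (simp add: Sbar_summand_def mult.assoc fps_X_power_mult_nth del: power_Suc)

text \<open>
  On the right-hand side the arguments of \<open>nat\<close> are nonnegative and the division by \<open>2\<close> is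
  exact, because \<open>2 * \<bar>m\<bar> \<le> n\<close> and \<open>n\<^sup>2 + n\<close> is even.
\<close>

lemma summable_rhs:
  "summable (\<lambda>n::nat. \<Sum>m\<in>{-\<lfloor>real n / 2\<rfloor>..\<lfloor>real n / 2\<rfloor>}.
     (-1) ^ nat (m + int n) *
     fps_const ((1 - zpow (int n - 2 * \<bar>m\<bar> + 1)) * (1 - zpow (int n - 2 * \<bar>m\<bar>)) *
                zpow (2 * \<bar>m\<bar> - int n)) *
     fps_X ^ nat (((int n)\<^sup>2 - 2 * m\<^sup>2 + int n) div 2))"
proof (rule fps_summableI, unfold fps_sum_nth, intro sum.neutral ballI)
  fix n k :: nat and m :: int
  assume k: "k < n" and "m \<in> {-\<lfloor>real n / 2\<rfloor>..\<lfloor>real n / 2\<rfloor>}"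
  then have "m \<le> \<lfloor>real n / 2\<rfloor>" "-m \<le> \<lfloor>real n / 2\<rfloor>"
    by auto
  then have "real_of_int m \<le> real n / 2" "real_of_int (-m) \<le> real n / 2"
    unfolding le_floor_iff .
  then have m: "2 * \<bar>m\<bar> \<le> int n"
    by linarith
  have "2 * m\<^sup>2 + int n \<le> (int n)\<^sup>2"
  proof (cases "n = 1")
    case True
    with m show ?thesis by auto
  next
    case False
    then have "2 * int n \<le> (int n)\<^sup>2"
      using k by (simp add: power2_eq_square)
    moreover have "4 * m\<^sup>2 \<le> (int n)\<^sup>2"
      using power_mono[OF m, of 2] by (simp add: power_mult_distrib)
    ultimately show ?thesis by linarith
  qed
  then have "int n \<le> ((int n)\<^sup>2 - 2 * m\<^sup>2 + int n) div 2"
    by linarith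
  then show "fps_nth ((-1) ^ nat (m + int n) *
      fps_const ((1 - zpow (int n - 2 * \<bar>m\<bar> + 1)) * (1 - zpow (int n - 2 * \<bar>m\<bar>)) *
                 zpow (2 * \<bar>m\<bar> - int n)) *
      fps_X ^ nat (((int n)\<^sup>2 - 2 * m\<^sup>2 + int n) div 2)) k = 0"
    unfolding fps_X_power_mult_right_nth using k by (intro if_P) linarith
qed

end

theory Submission
  imports Defs
begin

text \<open>
  Multiply by \<open>(q;q)\<^sub>\<infinity>\<close>. Since \<open>(z;q)\<^sub>\<infinity> / (zq\<^sup>n;q)\<^sub>\<infinity> = (z;q)\<^sub>n\<close>, the \<open>n\<close>-th term of the series on
  the left contains \<open>(1 + z)(z;q)\<^sub>n(1/z;q)\<^sub>n\<close>, and a finite form of the triple product expands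
  this Laurent polynomial in the basis \<open>y\<^sub>j = z\<^sup>-\<^sup>j + z\<^sup>j\<^sup>+\<^sup>1\<close>. For \<open>n \<ge> 1\<close> its coefficients add up to \<open>0\<close>
  (put \<open>z = 1\<close>), so that \<open>y\<^sub>j\<close> may be replaced by \<open>y\<^sub>j - y\<^sub>0\<close>. With \<open>b = q\<^sup>2\<^sup>j\<^sup>+\<^sup>1\<close>, summing the
  coefficient of \<open>y\<^sub>j - y\<^sub>0\<close> over \<open>n\<close> comes down to
  \[(q;q)_\infty (bq;q^2)_\infty \sum_{i \ge 0} \frac{q^i (b;q^2)_i}{(q;q)_i (bq;q)_i}
    = 1 + 2 \sum_{m \ge 1} (-1)^m q^{m^2} b^m.\]
  Both sides satisfy \<open>F(b) + qb F(bq\<^sup>2) = 1 - qb\<close>, the left one by creative telescoping, and this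
  equation has only one \<open>q\<close>-adic solution. The right-hand side of the theorem appears on
  putting \<open>n = j + 2\<bar>m\<bar>\<close>.
\<close>

section \<open>Congruences modulo \<open>q^N\<close> and the truncation of infinite sums and
  products\<close>

definition qcong :: "nat \<Rightarrow> 'a::comm_ring_1 fps \<Rightarrow> 'a fps \<Rightarrow> bool" where
  "qcong N f g \<longleftrightarrow> (\<forall>k<N. fps_nth f k = fps_nth g k)"

lemma qcong_refl [simp, intro]: "qcong N f f"
  by (simp add: qcong_def)

lemma qcong_sym: "qcong N f g \<Longrightarrow> qcong N g f"
  by (simp add: qcong_def)

lemma qcong_trans [trans]: "qcong N f g \<Longrightarrow> qcong N g h \<Longrightarrow> qcong N f h"
  by (simp add: qcong_def)

lemma qcong_mono: "qcong N f g \<Longrightarrow> M \<le> N \<Longrightarrow> qcong M f g"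
  by (simp add: qcong_def)

lemma qcong_add: "qcong N f g \<Longrightarrow> qcong N f' g' \<Longrightarrow> qcong N (f + f') (g + g')"
  by (simp add: qcong_def)

lemma qcong_diff: "qcong N f g \<Longrightarrow> qcong N f' g' \<Longrightarrow> qcong N (f - f') (g - g')"
  by (simp add: qcong_def)

lemma qcong_mult: "qcong N f g \<Longrightarrow> qcong N f' g' \<Longrightarrow> qcong N (f * f') (g * g')"
  by (auto simp: qcong_def fps_mult_nth intro!: sum.cong)

lemma qcong_sum: "(\<And>i. i \<in> A \<Longrightarrow> qcong N (f i) (g i)) \<Longrightarrow> qcong N (sum f A) (sum g A)"
  by (induction A rule: infinite_finite_induct) (auto intro: qcong_add)

lemma qcong_prod: "(\<And>i. i \<in> A \<Longrightarrow> qcong N (f i) (g i)) \<Longrightarrow> qcong N (prod f A) (prod g A)"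
  by (induction A rule: infinite_finite_induct) (auto intro: qcong_mult)

lemma qcong_eqI: "(\<And>N. qcong N f g) \<Longrightarrow> f = g"
  unfolding qcong_def fps_eq_iff by blast

lemma qcong_0I: "fps_X ^ n dvd f \<Longrightarrow> N \<le> n \<Longrightarrow> qcong N f 0"
  by (auto simp: qcong_def fps_X_power_mult_nth elim!: dvdE)

text \<open>Divisibility of \<open>f n\<close> by \<open>q^n\<close> makes the series summable and
  kills all terms with index at least \<open>N\<close> modulo \<open>q^N\<close>. This reduces every
  infinite sum below to a finite one.\<close>

lemma qcong_suminf:
  assumes "\<And>n. fps_X ^ n dvd f n"
  shows "qcong N (suminf f) (\<Sum>n<N. f n)"
  unfolding qcong_def
proof (intro allI impI)
  fix k assume k: "k < N"
  have "fps_nth (f n) k = 0" if "k < n" for n k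
    using qcong_0I[OF assms[of n], of n] that by (simp add: qcong_def)
  then have "summable f"
    by (rule fps_summableI)
  then have "(\<lambda>M. \<Sum>n<M. f n) \<longlonglongrightarrow> suminf f"
    using summable_sums sums_def by blast
  then have "eventually (\<lambda>M. fps_nth (\<Sum>n<M. f n) k = fps_nth (suminf f) k) sequentially"
    by (simp add: tendsto_fps_iff)
  then obtain M where M: "M \<ge> N" "fps_nth (\<Sum>n<M. f n) k = fps_nth (suminf f) k"
    using eventually_happens'[OF _ eventually_conj[OF eventually_ge_at_top[of N]]] by force
  have "qcong N (\<Sum>n<M. f n) (\<Sum>n<N. f n)"
  proof -
    have "(\<Sum>n<M. f n) = (\<Sum>n<N. f n) + (\<Sum>n=N..<M. f n)"
      using M(1) by (metis atLeast0LessThan le0 sum.atLeastLessThan_concat)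
    moreover have "qcong N (\<Sum>n=N..<M. f n) (\<Sum>n=N..<M. 0)"
      by (intro qcong_sum qcong_0I[OF assms]) auto
    ultimately show ?thesis
      by (simp add: qcong_def)
  qed
  with M k show "fps_nth (suminf f) k = fps_nth (\<Sum>n<N. f n) k"
    by (simp add: qcong_def)
qed

text \<open>The factors with index at least \<open>N\<close> are 1 modulo \<open>q^N\<close>,
  because \<open>a * q ^ k\<close> is divisible by \<open>fps_X ^ k\<close>.\<close>

lemma qcong_qpoch:
  fixes a q :: "'a::idom fps"
  assumes q: "fps_X dvd q" and a: "fps_nth a 0 \<noteq> 1"
  shows "qcong N (qpoch a q) (\<Prod>k<N. 1 - a * q ^ k)"
  unfolding qcong_def
proof (intro allI impI)
  fix k assume k: "k < N"
  have "fps_nth q 0 = 0"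
    using q by (auto elim!: dvdE)
  then have hp: "(\<lambda>k. 1 - a * q ^ k) has_prod qpoch a q"
    using a by (rule qpoch_has_prod)
  \<comment> \<open>Without vanishing factors, \<open>has_prod\<close> is the plain limit of the
    partial products from index 0 on.\<close>
  have "1 - a * q ^ i \<noteq> 0" for i
  proof
    assume "1 - a * q ^ i = 0"
    then have "fps_nth (1 - a * q ^ i) 0 = 0" by simp
    with a \<open>fps_nth q 0 = 0\<close> show False
      by (cases i) auto
  qed
  then have "raw_has_prod (\<lambda>k. 1 - a * q ^ k) 0 (qpoch a q)"
    using hp by (auto simp: has_prod_def)
  then have "(\<lambda>n. \<Prod>k\<le>n. 1 - a * q ^ k) \<longlonglongrightarrow> qpoch a q"
    by (simp add: raw_has_prod_def)
  then have "eventually (\<lambda>M. fps_nth (\<Prod>k\<le>M. 1 - a * q ^ k) k = fps_nth (qpoch a q) k) sequentially"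
    by (simp add: tendsto_fps_iff)
  then obtain M where M: "M \<ge> N" "fps_nth (\<Prod>k\<le>M. 1 - a * q ^ k) k = fps_nth (qpoch a q) k"
    using eventually_happens'[OF _ eventually_conj[OF eventually_ge_at_top[of N]]] by force
  have "qcong N (\<Prod>k\<le>M. 1 - a * q ^ k) (\<Prod>k<N. 1 - a * q ^ k)"
  proof -
    have "(\<Prod>k\<le>M. 1 - a * q ^ k) = (\<Prod>k<N. 1 - a * q ^ k) * (\<Prod>k=N..<Suc M. 1 - a * q ^ k)"
      using M(1) prod.atLeastLessThan_concat[of 0 N "Suc M" "\<lambda>k. 1 - a * q ^ k"]
      by (simp add: atLeast0LessThan lessThan_Suc_atMost del: prod.op_ivl_Suc)
    moreover have "qcong N (\<Prod>k=N..<Suc M. 1 - a * q ^ k) (\<Prod>k=N..<Suc M. 1 - 0)"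
      using q by (intro qcong_prod qcong_diff qcong_refl qcong_0I[of _ "a * q ^ _"])
        (auto intro: dvd_mult dvd_power_same)
    ultimately show ?thesis
      using qcong_mult[OF qcong_refl, of N _ 1 "\<Prod>k<N. 1 - a * q ^ k"] by simp
  qed
  with M k show "fps_nth (qpoch a q) k = fps_nth (\<Prod>k<N. 1 - a * q ^ k) k"
    by (simp add: qcong_def)
qed

lemma qpoch_Suc:
  fixes a q :: "'a::idom fps"
  assumes q: "fps_X dvd q" and a: "fps_nth a 0 \<noteq> 1"
  shows "qpoch a q = (1 - a) * qpoch (a * q) q"
proof (rule qcong_eqI)
  fix N
  have aq: "fps_nth (a * q) 0 \<noteq> 1"
    using q by (auto elim!: dvdE)
  have "qcong N (qpoch a q) (\<Prod>k<Suc N. 1 - a * q ^ k)"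
    using qcong_qpoch[OF q a, of "Suc N"] by (rule qcong_mono) simp
  also have "(\<Prod>k<Suc N. 1 - a * q ^ k) = (1 - a) * (\<Prod>k<N. 1 - a * q * q ^ k)"
    by (subst prod.lessThan_Suc_shift) (simp add: mult.assoc)
  also have "qcong N ((1 - a) * (\<Prod>k<N. 1 - a * q * q ^ k)) ((1 - a) * qpoch (a * q) q)"
    by (intro qcong_mult qcong_refl qcong_sym[OF qcong_qpoch[OF q aq]])
  finally show "qcong N (qpoch a q) ((1 - a) * qpoch (a * q) q)" .
qed

lemma qpoch_split:
  fixes a q :: "'a::idom fps"
  assumes q: "fps_X dvd q" and a: "fps_nth a 0 \<noteq> 1"
  shows "qpoch a q = (\<Prod>k<n. 1 - a * q ^ k) * qpoch (a * q ^ n) q"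
proof (induction n)
  case (Suc n)
  have "fps_nth (a * q ^ n) 0 \<noteq> 1"
    using q a by (cases n) (auto elim!: dvdE)
  from qpoch_Suc[OF q this] Suc show ?case
    by (simp add: mult_ac)
qed auto

section \<open>The tails \<open>(q^k;q)_inf\<close> and the even and odd parts of
  \<open>(q;q)_(2n)\<close>\<close>

definition euler_tail :: "nat \<Rightarrow> 'a::idom fps" where
  "euler_tail k = qpoch (fps_X ^ k) fps_X"

text \<open>The factor with index 0 is \<open>1 - 1\<close>, so \<open>qpoch_has_prod\<close> does
  not apply. The value comes from the clause of \<open>has_prod\<close> for a vanishing factor, once
  the remaining product \<open>(q;q)_inf\<close> is known to converge to a nonzero limit.\<close>

lemma euler_tail_0: "euler_tail 0 = (0 :: 'a::idom fps)"
proof -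
  have "(\<lambda>k. 1 - (fps_X :: 'a fps) * fps_X ^ k) has_prod qpoch fps_X fps_X"
    by (rule qpoch_has_prod) simp_all
  moreover have "(1 - (fps_X :: 'a fps) * fps_X ^ k) \<noteq> 0" for k
    by (metis fps_one_nth fps_sub_nth fps_zero_nth fps_X_mult_nth diff_zero zero_neq_one)
  ultimately have "raw_has_prod (\<lambda>k. 1 - (fps_X :: 'a fps) * fps_X ^ k) 0 (qpoch fps_X fps_X)"
    by (auto simp: has_prod_def)
  then have "raw_has_prod (\<lambda>k. 1 - (1 :: 'a fps) * fps_X ^ k) (Suc 0) (qpoch fps_X fps_X)"
    by (simp add: raw_has_prod_def)
  then have "(\<lambda>k. 1 - (1 :: 'a fps) * fps_X ^ k) has_prod 0"
    unfolding has_prod_def by (intro disjI2 exI[of _ 0] conjI exI) auto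
  then show ?thesis
    unfolding euler_tail_def qpoch_def using has_prod_unique by fastforce
qed

text \<open>This replaces division by \<open>(q;q)_k\<close> throughout. It survives at
  \<open>k = 0\<close>, where both sides are 0.\<close>

lemma euler_tail_rec: "euler_tail k = (1 - fps_X ^ k) * euler_tail (Suc k)"
proof (cases "k = 0")
  case False
  then show ?thesis
    unfolding euler_tail_def by (subst qpoch_Suc) (simp_all add: mult.commute)
qed (simp add: euler_tail_0)

lemma qcong_euler_tail: "N \<le> k \<Longrightarrow> qcong N (euler_tail k) (1 :: 'a::idom fps)"
proof (cases "k = 0")
  case False
  assume N: "N \<le> k"
  have "qcong N (euler_tail k) (\<Prod>i<N. 1 - fps_X ^ k * fps_X ^ i :: 'a fps)"
    unfolding euler_tail_def using False by (intro qcong_qpoch) auto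
  also have "qcong N (\<Prod>i<N. 1 - fps_X ^ k * fps_X ^ i) (\<Prod>i<N. 1 - 0 :: 'a fps)"
    using N by (intro qcong_prod qcong_diff qcong_refl qcong_0I[of k]) auto
  finally show ?thesis by simp
qed (simp add: qcong_def)

lemma qcong_sum_mono_neutral:
  assumes "finite B" "A \<subseteq> B" "\<And>x. x \<in> B - A \<Longrightarrow> qcong N (f x) 0"
  shows "qcong N (sum f A) (sum f B)"
proof -
  have "sum f B = sum f A + sum f (B - A)"
    using assms(1,2) by (metis sum.subset_diff add.commute)
  moreover have "qcong N (sum f (B - A)) (\<Sum>x\<in>B - A. 0)"
    using assms(3) by (rule qcong_sum)
  ultimately show ?thesis
    by (simp add: qcong_def)
qed

definition odd_prod :: "nat \<Rightarrow> 'a::comm_ring_1 fps" where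
  "odd_prod n = (\<Prod>k<n. 1 - fps_X ^ (2 * k + 1))"

definition even_prod :: "nat \<Rightarrow> 'a::comm_ring_1 fps" where
  "even_prod n = (\<Prod>k<n. 1 - fps_X ^ (2 * k + 2))"

lemma odd_prod_Suc: "odd_prod (Suc n) = odd_prod n * (1 - fps_X ^ (2 * n + 1))"
  by (simp add: odd_prod_def)

lemma even_prod_Suc: "even_prod (Suc n) = even_prod n * (1 - fps_X ^ (2 * n + 2))"
  by (simp add: even_prod_def)

lemma even_prod_mult_odd_prod:
  "even_prod n * odd_prod n = (\<Prod>k<2 * n. 1 - fps_X * fps_X ^ k)"
  by (induction n) (simp_all add: even_prod_def odd_prod_def mult_ac)

text \<open>The even half of \<open>(q;q)_(2n)\<close> completes the numerator of the
  \<open>n\<close>-th summand to a factor that does not depend on \<open>n\<close>; the odd half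
  stays in \<open>theta_summand\<close>.\<close>

lemma even_prod_mult_tail:
  "even_prod n * qpoch (fps_X ^ (2 * n + 2)) (fps_X\<^sup>2) = qpoch (fps_X\<^sup>2) (fps_X\<^sup>2 :: 'a::idom fps)"
proof -
  have X2: "fps_X\<^sup>2 * (fps_X\<^sup>2) ^ k = (fps_X ^ (2 * k + 2) :: 'a fps)" for k
    by (metis power_add power_mult add.commute)
  have "qpoch (fps_X\<^sup>2) (fps_X\<^sup>2 :: 'a fps) =
      (\<Prod>k<n. 1 - fps_X\<^sup>2 * (fps_X\<^sup>2) ^ k) * qpoch (fps_X\<^sup>2 * (fps_X\<^sup>2) ^ n) (fps_X\<^sup>2)"
    by (rule qpoch_split) (simp_all add: dvd_power)
  then show ?thesis
    unfolding X2 even_prod_def by simp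
qed

text \<open>From \<open>(q^2;q^2)_inf (q;q^2)_inf = (q;q)_inf\<close>; evaluates the upper boundary
  term of the telescoping sum.\<close>

lemma qcong_even_mult_odd_prod:
  assumes "N \<le> n"
  shows "qcong N (qpoch (fps_X\<^sup>2) (fps_X\<^sup>2) * odd_prod n) (euler_tail 1 :: 'a::idom fps)"
proof -
  have X2: "(fps_X\<^sup>2) ^ k = (fps_X ^ (2 * k) :: 'a fps)" for k
    by (simp add: power_mult)
  have "qcong n (qpoch (fps_X\<^sup>2) (fps_X\<^sup>2)) (\<Prod>k<n. 1 - fps_X\<^sup>2 * (fps_X\<^sup>2) ^ k :: 'a fps)"
    by (rule qcong_qpoch) (simp_all add: power2_eq_square)
  also have "\<dots> = even_prod n"
    unfolding even_prod_def X2 by (simp add: power2_eq_square mult.assoc)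
  finally have "qcong n (qpoch (fps_X\<^sup>2) (fps_X\<^sup>2) * odd_prod n) (even_prod n * odd_prod n :: 'a fps)"
    by (intro qcong_mult qcong_refl)
  also have "\<dots> = (\<Prod>k<2 * n. 1 - fps_X * fps_X ^ k)"
    by (rule even_prod_mult_odd_prod)
  also have "qcong n \<dots> (euler_tail 1)"
    unfolding euler_tail_def power_one_right
    by (rule qcong_sym, rule qcong_mono[of "2 * n"], rule qcong_qpoch) auto
  finally show ?thesis
    using assms by (rule qcong_mono)
qed

section \<open>The finite form of the triple product\<close>

definition tri :: "nat \<Rightarrow> 'a::comm_ring_1 fps" where
  "tri j = (-1) ^ j * fps_X ^ (j choose 2)"

lemma tri_0 [simp]: "tri 0 = 1"
  by (simp add: tri_def numeral_2_eq_2)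

lemma tri_Suc: "tri (Suc j) = - (fps_X ^ j * tri j)"
  by (simp add: tri_def numeral_2_eq_2 power_add)

text \<open>
  The coefficient of \<open>y\<^sub>j\<close> in \<open>(q;q)\<^sub>\<infinity>\<^sup>2 (1 + z)(z;q)\<^sub>n(1/z;q)\<^sub>n\<close>. For \<open>j > n\<close> the subtraction is
  truncated and \<open>euler_tail 0 = 0\<close>, so the formula correctly gives \<open>0\<close>.
\<close>

definition jacobi_coeff :: "nat \<Rightarrow> nat \<Rightarrow> 'a::idom fps" where
  "jacobi_coeff n j = tri j * (1 - fps_X ^ (2 * j + 1)) * euler_tail (Suc n - j) *
     euler_tail (n + j + 2) * (even_prod n * odd_prod n)"

lemma fps_X_power_odd: "fps_X ^ (2 * j + 1) = fps_X * fps_X ^ j * (fps_X ^ j :: 'a::comm_ring_1 fps)"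
  by (simp add: mult_2 power_add mult.assoc)

lemma jacobi_coeff_eq_0: "n < j \<Longrightarrow> jacobi_coeff n j = 0"
  by (simp add: jacobi_coeff_def euler_tail_0)

lemma euler_tail_rec2:
  "euler_tail k = (1 - fps_X ^ k) * (1 - fps_X * fps_X ^ k) * euler_tail (k + 2)"
  by (subst euler_tail_rec, subst euler_tail_rec) (simp add: mult.assoc)

text \<open>The boundary case of the recurrence \<open>jacobi_coeff_Suc_Suc\<close>: the coefficient
  with index 0 stands in for the one with index -1, because \<open>y_(-1) = y_0\<close>.\<close>

lemma jacobi_coeff_Suc_0:
  "jacobi_coeff (Suc n) 0 = (
     (1 + fps_X ^ (2 * n)) * jacobi_coeff n 0 -
     fps_X ^ n * (jacobi_coeff n 0 + jacobi_coeff n 1) :: 'a::idom fps)"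
proof -
  \<comment> \<open>Neighbouring tails differ by one factor. With all of them expressed through the
    last one, the claim is a polynomial identity in the named quantities.\<close>
  define A B C D u v q where "A = (euler_tail n :: 'a fps)" and "B = (euler_tail (n + 1) :: 'a fps)"
    and "C = (euler_tail (n + 2) :: 'a fps)" and "D = (euler_tail (n + 3) :: 'a fps)"
    and "u = (fps_X ^ n :: 'a fps)" and "v = (even_prod n * odd_prod n :: 'a fps)"
    and "q = (fps_X :: 'a fps)"
  note defs = this
  have A: "A = (1 - u) * B" and B: "B = (1 - q * u) * C" and C: "C = (1 - q * q * u) * D"
    unfolding defs using euler_tail_rec[of n] euler_tail_rec[of "n + 1"] euler_tail_rec[of "n + 2"]
    by (simp_all add: numeral_2_eq_2 numeral_3_eq_3 mult.assoc)
  have uu: "fps_X ^ (2 * n) = u * u"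
    by (simp add: defs mult_2 power_add)
  have c: "jacobi_coeff (Suc n) 0 = (1 - q) * C * D * (v * ((1 - q * q * (u * u)) * (1 - q * (u * u))))"
    by (simp add: jacobi_coeff_def even_prod_Suc odd_prod_Suc uu numeral_3_eq_3)
      (simp add: defs numeral_3_eq_3 mult_ac)
  have c0: "jacobi_coeff n 0 = (1 - q) * B * C * v"
    by (simp add: defs jacobi_coeff_def)
  have c1: "jacobi_coeff n 1 = - (1 - q * q * q) * A * D * v"
    by (simp add: defs jacobi_coeff_def tri_Suc numeral_3_eq_3 mult_ac)
  show ?thesis
    unfolding c c0 c1 uu A B C by (fold \<open>u = fps_X ^ n\<close>) algebra
qed

text \<open>Passing from \<open>n\<close> to \<open>n + 1\<close> multiplies the product by
  \<open>1 - c q^n + q^(2n)\<close> with \<open>c = z + 1/z\<close>, and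
  \<open>c y_j = y_(j+1) + y_(j-1)\<close> turns this into a three-term rule for the
  coefficients.\<close>

lemma jacobi_coeff_Suc_Suc:
  "jacobi_coeff (Suc n) (Suc j) = (
     (1 + fps_X ^ (2 * n)) * jacobi_coeff n (Suc j) -
     fps_X ^ n * (jacobi_coeff n j + jacobi_coeff n (Suc (Suc j))) :: 'a::idom fps)"
proof -
  consider "Suc j \<le> n" | "j = n" | "n < j" by linarith
  then show ?thesis
  proof cases
    case 1
    \<comment> \<open>With \<open>i = n - j - 1\<close> the truncated subtractions are exact, and
      the three tails involved start at \<open>i\<close>, \<open>i + 1\<close> and
      \<open>i + 2\<close>.\<close>
    then obtain i where n: "n = i + Suc j"
      by (metis add.commute le_Suc_ex)
    define A B C D E F u w v p q where "A = (euler_tail i :: 'a fps)"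
      and "B = (euler_tail (i + 1) :: 'a fps)"
      and "C = (euler_tail (i + 2) :: 'a fps)" and "D = (euler_tail (n + j + 2) :: 'a fps)"
      and "E = (euler_tail (n + j + 3) :: 'a fps)" and "F = (euler_tail (n + j + 4) :: 'a fps)"
      and "u = (fps_X ^ i :: 'a fps)" and "w = (fps_X ^ j :: 'a fps)"
      and "v = (even_prod n * odd_prod n :: 'a fps)"
      and "p = (tri j :: 'a fps)" and "q = (fps_X :: 'a fps)"
    note defs = this
    have A: "A = (1 - u) * B" and B: "B = (1 - q * u) * C"
      unfolding defs using euler_tail_rec[of i] euler_tail_rec[of "i + 1"]
      by simp_all
    have D: "D = (1 - q * q * q * u * w * w) * E" and E: "E = (1 - q * q * q * q * u * w * w) * F"
      unfolding defs n using euler_tail_rec[of "i + Suc j + j + 2"] euler_tail_rec[of "i + Suc j + j + 3"]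
      by (simp_all add: power_add mult_ac numeral_eq_Suc)
    have un: "fps_X ^ n = q * u * w"
      by (simp add: defs n power_add mult_ac)
    then have un2: "fps_X ^ (2 * n) = q * u * w * (q * u * w)"
      unfolding mult_2 power_add by simp
    have c: "jacobi_coeff (Suc n) (Suc j) = - (w * p) * (1 - q * q * q * w * w) * C * F *
        (v * ((1 - q * q * (q * u * w * (q * u * w))) * (1 - q * (q * u * w * (q * u * w)))))"
    proof -
      have "Suc (Suc n) - Suc j = i + 2" "Suc n + Suc j + 2 = n + j + 4" using n by simp_all
      moreover have "fps_X ^ (2 * Suc j + 1) = q * q * q * w * w"
        unfolding fps_X_power_odd by (simp add: defs mult_ac)
      moreover have "even_prod (Suc n) * odd_prod (Suc n) =
          v * ((1 - q * q * (q * u * w * (q * u * w))) * (1 - q * (q * u * w * (q * u * w))))"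
        unfolding even_prod_Suc odd_prod_Suc power_add un2 by (simp add: defs mult_ac power2_eq_square)
      ultimately show ?thesis
        by (simp only: jacobi_coeff_def tri_Suc) (simp add: defs numeral_eq_Suc mult_ac)
    qed
    have c0: "jacobi_coeff n j = p * (1 - q * w * w) * C * D * v"
    proof -
      have "Suc n - j = i + 2" using n by simp
      moreover have "fps_X ^ (2 * j + 1) = q * w * w"
        unfolding fps_X_power_odd by (simp add: defs mult_ac)
      ultimately show ?thesis
        unfolding jacobi_coeff_def defs by simp
    qed
    have c1: "jacobi_coeff n (Suc j) = - (w * p) * (1 - q * q * q * w * w) * B * E * v"
    proof -
      have "Suc n - Suc j = i + 1" "n + Suc j + 2 = n + j + 3" using n by simp_all
      moreover have "fps_X ^ (2 * Suc j + 1) = q * q * q * w * w"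
        unfolding fps_X_power_odd by (simp add: defs mult_ac)
      ultimately show ?thesis
        by (simp only: jacobi_coeff_def tri_Suc) (simp add: defs numeral_eq_Suc mult_ac)
    qed
    have c2: "jacobi_coeff n (Suc (Suc j)) =
        q * w * (w * p) * (1 - q * q * q * q * q * w * w) * A * F * v"
    proof -
      have "Suc n - Suc (Suc j) = i" "n + Suc (Suc j) + 2 = n + j + 4" using n by simp_all
      moreover have "fps_X ^ (2 * Suc (Suc j) + 1) = q * q * q * q * q * w * w"
        unfolding fps_X_power_odd by (simp add: defs mult_ac)
      ultimately show ?thesis
        by (simp only: jacobi_coeff_def tri_Suc) (simp add: defs numeral_eq_Suc mult_ac)
    qed
    show ?thesis
      unfolding c c0 c1 c2 un un2 A B D E by algebra
  next
    \<comment> \<open>At the top index only \<open>jacobi_coeff n n\<close> survives on the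
      right.\<close>
    case 2
    define B D F w v p q where "B = (euler_tail 1 :: 'a fps)"
      and "D = (euler_tail (2 * n + 2) :: 'a fps)" and "F = (euler_tail (2 * n + 4) :: 'a fps)"
      and "w = (fps_X ^ n :: 'a fps)" and "v = (even_prod n * odd_prod n :: 'a fps)"
      and "p = (tri n :: 'a fps)" and "q = (fps_X :: 'a fps)"
    note defs = this
    have X2n: "fps_X ^ (2 * n) = w * w"
      by (simp add: defs mult_2 power_add)
    have D: "D = (1 - q * q * w * w) * (1 - q * q * q * w * w) * F"
      unfolding defs using euler_tail_rec2[of "2 * n + 2"]
      by (simp add: power_add mult_2 mult_ac numeral_eq_Suc)
    have c: "jacobi_coeff (Suc n) (Suc n) = - (w * p) * (1 - q * q * q * w * w) * B * F *
        (v * ((1 - q * q * w * w) * (1 - q * w * w)))"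
    proof -
      have "Suc (Suc n) - Suc n = 1" "Suc n + Suc n + 2 = 2 * n + 4" by simp_all
      moreover have "fps_X ^ (2 * Suc n + 1) = q * q * q * w * w"
        unfolding fps_X_power_odd by (simp add: defs mult_ac)
      moreover have "even_prod (Suc n) * odd_prod (Suc n) = v * ((1 - q * q * w * w) * (1 - q * w * w))"
        unfolding even_prod_Suc odd_prod_Suc power_add X2n
        by (simp add: defs mult_ac power2_eq_square)
      ultimately show ?thesis
        by (simp only: jacobi_coeff_def tri_Suc) (simp add: defs numeral_eq_Suc mult_ac)
    qed
    have c0: "jacobi_coeff n n = p * (1 - q * w * w) * B * D * v"
    proof -
      have "Suc n - n = 1" "n + n + 2 = 2 * n + 2" by simp_all
      moreover have "fps_X ^ (2 * n + 1) = q * w * w"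
        unfolding fps_X_power_odd by (simp add: defs mult_ac)
      ultimately show ?thesis
        by (simp only: jacobi_coeff_def) (simp add: defs mult_ac)
    qed
    show ?thesis
      unfolding 2 c c0 D by (simp add: jacobi_coeff_eq_0 algebra_simps flip: \<open>w = fps_X ^ n\<close>)
  next
    case 3
    then show ?thesis
      by (simp add: jacobi_coeff_eq_0)
  qed
qed

lemma sum_three_term_swap:
  fixes y a :: "nat \<Rightarrow> 'a::comm_ring_1"
  assumes y1: "y 1 = (c - 1) * y 0" and y: "\<And>j. y (Suc (Suc j)) = c * y (Suc j) - y j"
    and a: "\<And>j. j > n \<Longrightarrow> a j = 0"
  shows "c * (\<Sum>j\<le>n. y j * a j) =
    y 0 * (a 0 + a 1) + (\<Sum>j\<le>n. y (Suc j) * (a j + a (Suc (Suc j))))"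
proof -
  \<comment> \<open>For a general cutoff, summation by parts leaves two boundary terms; both vanish
    at \<open>M = Suc n\<close>.\<close>
  have "c * (\<Sum>j\<le>M. y j * a j) =
      y 0 * (a 0 + a 1) + (\<Sum>j<M. y (Suc j) * (a j + a (Suc (Suc j)))) + y (Suc M) * a M - y M * a (Suc M)" for M
  proof (induction M)
    case 0
    show ?case by (simp add: y1[unfolded One_nat_def] algebra_simps)
  next
    case (Suc M)
    show ?case
      using Suc.IH by (simp add: y algebra_simps)
  qed
  from this[of "Suc n"] show ?thesis
    using a by (simp add: lessThan_Suc_atMost)
qed

text \<open>Induction on \<open>n\<close> by the recurrence for the coefficients. Only the
  three-term relation of \<open>y\<close> enters, so the result serves both for \<open>zsym\<close>
  with \<open>c = z + 1/z\<close> and for the constant sequence 1 with \<open>c = 2\<close>.\<close>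

lemma finite_triple_product:
  fixes y :: "nat \<Rightarrow> 'a::idom fps"
  assumes y1: "y 1 = (c - 1) * y 0" and y: "\<And>j. y (Suc (Suc j)) = c * y (Suc j) - y j"
  shows "(\<Sum>j\<le>n. y j * jacobi_coeff n j) =
    y 0 * (euler_tail 1)\<^sup>2 * (\<Prod>k<n. 1 - c * fps_X ^ k + fps_X ^ (2 * k))"
proof (induction n)
  case 0
  have "(1 - fps_X) * euler_tail (Suc (Suc 0)) = (euler_tail (Suc 0) :: 'a fps)"
    using euler_tail_rec[of "Suc 0"] by (metis power_one_right One_nat_def)
  then show ?case
    by (simp add: jacobi_coeff_def even_prod_def odd_prod_def power2_eq_square
        numeral_2_eq_2 mult_ac)
next
  case (Suc n)
  let ?a = "jacobi_coeff n :: nat \<Rightarrow> 'a fps"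
  have "(\<Sum>j\<le>Suc n. y j * jacobi_coeff (Suc n) j) =
      y 0 * jacobi_coeff (Suc n) 0 + (\<Sum>j\<le>n. y (Suc j) * jacobi_coeff (Suc n) (Suc j))"
    by (rule sum.atMost_Suc_shift)
  also have "\<dots> = (1 + fps_X ^ (2 * n)) * (y 0 * ?a 0 + (\<Sum>j\<le>n. y (Suc j) * ?a (Suc j))) -
      fps_X ^ n * (y 0 * (?a 0 + ?a 1) + (\<Sum>j\<le>n. y (Suc j) * (?a j + ?a (Suc (Suc j)))))"
    unfolding jacobi_coeff_Suc_0 jacobi_coeff_Suc_Suc
    by (simp add: algebra_simps sum_distrib_left sum.distrib sum_subtractf)
  also have "y 0 * ?a 0 + (\<Sum>j\<le>n. y (Suc j) * ?a (Suc j)) = (\<Sum>j\<le>n. y j * ?a j)"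
    using sum.atMost_Suc_shift[of "\<lambda>j. y j * ?a j" n] by (simp add: jacobi_coeff_eq_0)
  also have "y 0 * (?a 0 + ?a 1) + (\<Sum>j\<le>n. y (Suc j) * (?a j + ?a (Suc (Suc j)))) =
      c * (\<Sum>j\<le>n. y j * ?a j)"
    using sum_three_term_swap[OF y1 y, of n ?a] by (simp add: jacobi_coeff_eq_0)
  finally show ?case
    unfolding Suc by (simp add: algebra_simps)
qed

section \<open>The theta identity by creative telescoping\<close>

text \<open>
  Up to a factor independent of \<open>i\<close>, this is \<open>q\<^sup>i(b;q\<^sup>2)\<^sub>i / ((q;q)\<^sub>i(bq;q)\<^sub>i)\<close> for \<open>b = q\<^sup>2\<^sup>j\<^sup>+\<^sup>1\<close>. To avoid
  division, \<open>(q;q)\<^sub>\<infinity> / (q;q)\<^sub>i\<close> is written as \<open>euler_tail (i + 1)\<close>, and \<open>(bq;q)\<^sub>i\<close> is treated likewise.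
\<close>

definition theta_summand :: "nat \<Rightarrow> nat \<Rightarrow> 'a::idom fps" where
  "theta_summand j i = (1 - fps_X ^ (2 * j + 1)) * fps_X ^ i * euler_tail (i + 1) *
     euler_tail (2 * j + 2 + i) * odd_prod (i + j)"

text \<open>\<open>h\<close> is the telescoping certificate for \<open>F(b) + qb F(bq^2)\<close> at
  \<open>b = q^(2j+1)\<close>: passing to \<open>Suc j\<close> replaces \<open>b\<close> by
  \<open>bq^2\<close>, and \<open>q^(2j+2)\<close> is \<open>qb\<close>. Once all tails are reduced
  to \<open>B\<close> and \<open>E\<close>, the identity is polynomial.\<close>

lemma theta_summand_telescope:
  fixes h :: "nat \<Rightarrow> nat \<Rightarrow> 'a::idom fps"
  defines "h \<equiv> \<lambda>j i. euler_tail i * euler_tail (2 * j + 3 + i) * odd_prod (i + j) *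
    (1 - fps_X ^ (2 * j + 2) + fps_X ^ (2 * j + 1 + i) * (1 - fps_X))"
  shows "theta_summand j i + fps_X ^ (2 * j + 2) * theta_summand (Suc j) i = h j (Suc i) - h j i"
proof -
  define A B C D E u w v q where "A = (euler_tail i :: 'a fps)"
    and "B = (euler_tail (i + 1) :: 'a fps)"
    and "C = (euler_tail (2 * j + 2 + i) :: 'a fps)"
    and "D = (euler_tail (2 * j + 3 + i) :: 'a fps)"
    and "E = (euler_tail (2 * j + 4 + i) :: 'a fps)"
    and "u = (fps_X ^ i :: 'a fps)" and "w = (fps_X ^ j :: 'a fps)"
    and "v = (odd_prod (i + j) :: 'a fps)" and "q = (fps_X :: 'a fps)"
  note defs = this
  have A: "A = (1 - u) * B"
    unfolding defs using euler_tail_rec[of i] by simp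
  have X2j: "fps_X ^ (2 * j) = w * w"
    by (simp add: defs mult_2 power_add)
  have CD: "C = (1 - q * q * w * w * u) * D" "D = (1 - q * q * q * w * w * u) * E"
  proof -
    have "C = (1 - fps_X ^ (2 * j + 2 + i)) * D" "D = (1 - fps_X ^ (2 * j + 3 + i)) * E"
      unfolding defs using euler_tail_rec[of "2 * j + 2 + i"] euler_tail_rec[of "2 * j + 3 + i"]
      by (simp_all add: numeral_eq_Suc)
    moreover have "fps_X ^ (2 * j + 2 + i) = q * q * w * w * u"
      "fps_X ^ (2 * j + 3 + i) = q * q * q * w * w * u"
      unfolding power_add X2j by (simp_all add: defs power2_eq_square power3_eq_cube mult_ac)
    ultimately show "C = (1 - q * q * w * w * u) * D" "D = (1 - q * q * q * w * w * u) * E"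
      by simp_all
  qed
  have odd: "odd_prod (Suc (i + j)) = v * (1 - q * u * w * u * w)"
    unfolding odd_prod_Suc fps_X_power_odd by (simp add: defs power_add mult_ac)
  have t: "theta_summand j i = (1 - q * w * w) * u * B * C * v"
    unfolding theta_summand_def fps_X_power_odd by (simp add: defs)
  have t': "theta_summand (Suc j) i =
      (1 - q * q * q * w * w) * u * B * E * (v * (1 - q * u * w * u * w))"
  proof -
    have "2 * Suc j + 2 + i = 2 * j + 4 + i" "i + Suc j = Suc (i + j)" by simp_all
    then show ?thesis
      unfolding theta_summand_def fps_X_power_odd
      by (simp only: odd) (simp add: defs mult_ac)
  qed
  have p: "fps_X ^ (2 * j + 2) = q * q * w * w" "fps_X ^ (2 * j + 1 + i) = q * w * w * u"
    unfolding power_add X2j by (simp_all add: defs power2_eq_square mult_ac)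
  have h: "h j i = A * D * v * (1 - q * q * w * w + q * w * w * u * (1 - q))"
    unfolding h_def p by (simp add: defs)
  have h': "h j (Suc i) = B * E * (v * (1 - q * u * w * u * w)) *
      (1 - q * q * w * w + q * w * w * u * q * (1 - q))"
  proof -
    have "2 * j + 3 + Suc i = 2 * j + 4 + i" "Suc i + j = Suc (i + j)" by simp_all
    moreover have "fps_X ^ (2 * j + 1 + Suc i) = q * w * w * u * q"
      using p(2) by (simp add: q_def mult.commute)
    ultimately show ?thesis
      unfolding h_def p by (simp only: odd) (simp add: defs mult_ac)
  qed
  show ?thesis
    unfolding t t' p h h' A CD by algebra
qed

lemma sum_theta_summand:
  "(\<Sum>i<N. theta_summand j i + fps_X ^ (2 * j + 2) * theta_summand (Suc j) i :: 'a::idom fps) =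
    euler_tail N * euler_tail (2 * j + 3 + N) * odd_prod (N + j) *
    (1 - fps_X ^ (2 * j + 2) + fps_X ^ (2 * j + 1 + N) * (1 - fps_X))" (is "_ = ?h N")
proof -
  have "(\<Sum>i<N. theta_summand j i + fps_X ^ (2 * j + 2) * theta_summand (Suc j) i) =
      (\<Sum>i<N. ?h (Suc i) - ?h i)"
    by (intro sum.cong refl theta_summand_telescope)
  also have "\<dots> = ?h N - ?h 0"
    by (rule sum_lessThan_telescope)
  \<comment> \<open>The lower boundary term contains \<open>euler_tail 0 = 0\<close>.\<close>
  finally show ?thesis
    by (simp add: euler_tail_0)
qed

definition partial_theta :: "nat \<Rightarrow> nat \<Rightarrow> 'a::comm_ring_1 fps" where
  "partial_theta N j = (\<Sum>m<N. (-1) ^ m * fps_X ^ (m\<^sup>2 + m * (2 * j + 1)))"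

text \<open>Shifting \<open>m\<close> by one gives the functional equation
  \<open>G(b) = 1 - qb G(bq^2)\<close> for partial sums, at the cost of one term.\<close>

lemma partial_theta_Suc:
  "partial_theta (Suc N) j = 1 - fps_X ^ (2 * j + 2) * partial_theta N (Suc j)"
proof -
  have "(Suc m)\<^sup>2 + Suc m * (2 * j + 1) = (2 * j + 2) + (m\<^sup>2 + m * (2 * Suc j + 1))" for m :: nat
    by (simp add: power2_eq_square algebra_simps)
  then show ?thesis
    unfolding partial_theta_def
    by (subst sum.lessThan_Suc_shift)
      (simp add: power_add sum_distrib_left mult_ac flip: sum_negf)
qed

lemma qcong_partial_theta_Suc: "qcong N (partial_theta (Suc N) j) (partial_theta N j)"
proof -
  have "qcong N (partial_theta N j + (-1) ^ N * fps_X ^ (N\<^sup>2 + N * (2 * j + 1))) (partial_theta N j + 0)"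
    by (intro qcong_add qcong_refl qcong_0I[of N]) (auto intro!: dvd_mult le_imp_power_dvd)
  then show ?thesis
    by (simp add: partial_theta_def)
qed

text \<open>The identity of the overview times a further \<open>(q;q)_inf\<close>. The constant
  factors of \<open>theta_summand\<close> and \<open>(q^2;q^2)_inf\<close> combine to
  \<open>(q;q)_inf^2 (bq;q^2)_inf\<close>.\<close>

lemma qcong_theta_sum:
  fixes N j :: nat
  shows "qcong N (qpoch (fps_X\<^sup>2) (fps_X\<^sup>2) * (\<Sum>i<N. theta_summand j i))
    (euler_tail 1 * (2 * partial_theta (Suc N) j - 1) :: 'a::idom fps)"
proof -
  define H where "H j = qpoch (fps_X\<^sup>2) (fps_X\<^sup>2) * (\<Sum>i<N. theta_summand j i :: 'a fps)" for j
  define F where "F j = euler_tail 1 * (2 * partial_theta (Suc N) j - 1 :: 'a fps)" for j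
  have H: "qcong N (H j + fps_X ^ (2 * j + 2) * H (Suc j)) (euler_tail 1 * (1 - fps_X ^ (2 * j + 2)))" for j
  proof -
    have "H j + fps_X ^ (2 * j + 2) * H (Suc j) = qpoch (fps_X\<^sup>2) (fps_X\<^sup>2) *
        (\<Sum>i<N. theta_summand j i + fps_X ^ (2 * j + 2) * theta_summand (Suc j) i)"
      unfolding H_def sum.distrib sum_distrib_left[symmetric] by (simp only: distrib_left mult_ac)
    also have "\<dots> = (qpoch (fps_X\<^sup>2) (fps_X\<^sup>2) * odd_prod (N + j)) *
        (euler_tail N * euler_tail (2 * j + 3 + N) *
        (1 - fps_X ^ (2 * j + 2) + fps_X ^ (2 * j + 1 + N) * (1 - fps_X)))"
      unfolding sum_theta_summand by (simp only: mult_ac)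
    also have "qcong N \<dots> (euler_tail 1 * (1 * 1 * (1 - fps_X ^ (2 * j + 2) + 0)))"
      by (intro qcong_mult qcong_add qcong_refl qcong_even_mult_odd_prod qcong_euler_tail
          qcong_0I[of N] dvd_mult2 le_imp_power_dvd) simp_all
    finally show ?thesis by simp
  qed
  \<comment> \<open>The functional equation lowers the cutoff from \<open>Suc N\<close> to
    \<open>N\<close>; the term lost is 0 modulo \<open>q^N\<close>.\<close>
  have F: "qcong N (F j + fps_X ^ (2 * j + 2) * F (Suc j)) (euler_tail 1 * (1 - fps_X ^ (2 * j + 2)))" for j
  proof -
    have "F j + fps_X ^ (2 * j + 2) * F (Suc j) = euler_tail 1 * (1 - fps_X ^ (2 * j + 2) +
      2 * fps_X ^ (2 * j + 2) * (partial_theta (Suc N) (Suc j) - partial_theta N (Suc j)))"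
      unfolding F_def partial_theta_Suc[of N j] by (simp add: algebra_simps)
    also have "qcong N \<dots> (euler_tail 1 * (1 - fps_X ^ (2 * j + 2) +
      2 * fps_X ^ (2 * j + 2) * (partial_theta N (Suc j) - partial_theta N (Suc j))))"
      by (intro qcong_mult qcong_add qcong_diff qcong_refl qcong_partial_theta_Suc)
    finally show ?thesis by simp
  qed
  have step: "qcong N (H j - F j) (- (fps_X ^ (2 * j + 2) * (H (Suc j) - F (Suc j))))" for j
    using qcong_diff[OF H F, of j j] by (simp add: qcong_def algebra_simps)
  \<comment> \<open>Uniqueness of the solution: each use of \<open>step\<close> moves from
    \<open>j\<close> to \<open>j + 1\<close> and gains at least one factor \<open>q\<close>, so
    \<open>N\<close> uses give 0 modulo \<open>q^N\<close>.\<close>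
  have "\<exists>g. qcong N (H j - F j) (fps_X ^ k * g)" for k
  proof (induction k arbitrary: j)
    case 0
    show ?case by (intro exI[of _ "H j - F j"]) simp
  next
    case (Suc k)
    obtain g where g: "qcong N (H (Suc j) - F (Suc j)) (fps_X ^ k * g)"
      using Suc by blast
    note step[of j]
    also have "qcong N (- (fps_X ^ (2 * j + 2) * (H (Suc j) - F (Suc j))))
        (- (fps_X ^ (2 * j + 2) * (fps_X ^ k * g)))"
      using qcong_diff[OF qcong_refl[of N 0] qcong_mult[OF qcong_refl g]] by simp
    also have "\<dots> = fps_X ^ Suc k * (- (fps_X ^ (2 * j + 1)) * g)"
      by (simp add: mult_ac)
    finally show ?case by blast
  qed
  then obtain g where "qcong N (H j - F j) (fps_X ^ N * g)" by blast
  also have "qcong N (fps_X ^ N * g) 0"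
    by (rule qcong_0I[of N]) simp_all
  finally show ?thesis
    by (simp add: qcong_def H_def F_def)
qed

section \<open>Expansion of the left-hand side in the basis \<open>y_j\<close>\<close>

lemma fps_X_power_mult_jacobi_coeff:
  assumes "j \<le> n"
  shows "fps_X ^ n * jacobi_coeff n j = tri j * fps_X ^ j * theta_summand j (n - j) * even_prod n"
proof -
  obtain i where n: "n = j + i"
    using assms le_Suc_ex by blast
  have "Suc n - j = i + 1" "n + j + 2 = 2 * j + 2 + i"
    using n by simp_all
  then show ?thesis
    unfolding jacobi_coeff_def theta_summand_def
    by (simp only: n add_diff_cancel_left' power_add mult_ac add.commute[of i j])
qed

text \<open>For \<open>y = 1\<close> and \<open>c = 2\<close> the factor with \<open>k = 0\<close>
  is \<open>1 - 2 + 1\<close>; it is present because \<open>n > 0\<close>.\<close>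

lemma sum_jacobi_coeff_eq_0:
  assumes "n > 0"
  shows "(\<Sum>j\<le>n. jacobi_coeff n j) = (0 :: 'a::idom fps)"
proof -
  have "(\<Prod>k<n. 1 - 2 * fps_X ^ k + fps_X ^ (2 * k)) = (0 :: 'a fps)"
    using assms by (intro prod_zero) (auto intro!: bexI[of _ 0])
  then show ?thesis
    using finite_triple_product[of "\<lambda>_. 1 :: 'a fps" 2 n] by simp
qed

lemma zpow_mult: "zpow a * zpow b = zpow (a + b)"
  by (simp add: zpow_def mult_single)

lemma zpow_0 [simp]: "zpow 0 = 1"
  by (simp add: zpow_def)

text \<open>The basis \<open>y_j\<close>; \<open>y_0 = 1 + z\<close> is the prefactor in the
  theorem.\<close>

definition zsym :: "nat \<Rightarrow> laurent fps" where
  "zsym j = fps_const (zpow (- int j) + zpow (int j + 1))"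

definition zprod :: "nat \<Rightarrow> laurent fps" where
  "zprod n = (\<Prod>k<n. (1 - fps_const (zpow 1) * fps_X ^ k) * (1 - fps_const (zpow (-1)) * fps_X ^ k))"

lemma zprod_eq:
  "zprod n = (\<Prod>k<n. 1 - fps_const (zpow 1 + zpow (-1)) * fps_X ^ k + fps_X ^ (2 * k))"
  unfolding zprod_def
proof (rule prod.cong)
  fix k
  define z z' where "z = fps_const (zpow 1)" and "z' = fps_const (zpow (-1))"
  have "z * z' = 1"
    by (simp add: z_def z'_def zpow_mult)
  moreover have "(1 - z * fps_X ^ k) * (1 - z' * fps_X ^ k) =
      1 - (z + z') * fps_X ^ k + z * z' * (fps_X ^ k * fps_X ^ k)"
    by (simp add: algebra_simps)
  ultimately show "(1 - fps_const (zpow 1) * fps_X ^ k) * (1 - fps_const (zpow (-1)) * fps_X ^ k) =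
      1 - fps_const (zpow 1 + zpow (-1)) * fps_X ^ k + fps_X ^ (2 * k)"
    by (simp add: z_def z'_def mult_2 power_add)
qed simp

lemma sum_zsym_jacobi_coeff:
  "(\<Sum>j\<le>n. zsym j * jacobi_coeff n j) = zsym 0 * (euler_tail 1)\<^sup>2 * zprod n"
  unfolding zprod_eq
proof (rule finite_triple_product)
  show "zsym 1 = (fps_const (zpow 1 + zpow (-1)) - 1) * zsym 0"
    unfolding zsym_def by (simp add: algebra_simps zpow_mult flip: fps_const_1_eq_1)
  show "zsym (Suc (Suc j)) = fps_const (zpow 1 + zpow (-1)) * zsym (Suc j) - zsym j" for j
    unfolding zsym_def by (simp add: algebra_simps zpow_mult minus_diff_commute)
qed

lemma qpoch_mult_Sbar_summand:
  assumes "n > 0"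
  shows "qpoch (fps_const (zpow 1)) fps_X * qpoch (fps_const (zpow (-1))) fps_X * Sbar_summand n =
    fps_X ^ n * qpoch (fps_X ^ (2 * n + 2)) (fps_X\<^sup>2) * zprod n"
proof -
  have "qpoch (fps_const (zpow k)) fps_X =
      (\<Prod>i<n. 1 - fps_const (zpow k) * fps_X ^ i) * qpoch (fps_const (zpow k) * fps_X ^ n) fps_X"
    if "k \<noteq> 0" for k
    using that by (intro qpoch_split) (simp_all add: zpow_neq_1)
  then have "qpoch (fps_const (zpow 1)) fps_X * qpoch (fps_const (zpow (-1))) fps_X =
      zprod n * Sbar_denom n"
    by (simp add: zprod_def Sbar_denom_def prod.distrib mult_ac)
  then show ?thesis
    using Sbar_denom_inverse[of n] assms unfolding Sbar_summand_def
    by (simp add: mult_ac)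
qed

text \<open>The additional \<open>euler_tail 1\<close> supplies the square of
  \<open>(q;q)_inf\<close> built into \<open>jacobi_coeff\<close>; it is cancelled at the very
  end.\<close>

lemma Sbar_summand_expansion:
  assumes "n > 0"
  shows "euler_tail 1 * (fps_const (1 + zpow 1) * qpoch (fps_const (zpow 1)) fps_X *
       qpoch (fps_const (zpow (-1))) fps_X * euler_tail 1 * Sbar_summand n) =
    (\<Sum>j\<le>n. (zsym j - zsym 0) * (tri j * fps_X ^ j) *
       (qpoch (fps_X\<^sup>2) (fps_X\<^sup>2) * theta_summand j (n - j)))"
proof -
  define R where "R = qpoch (fps_X ^ (2 * n + 2)) (fps_X\<^sup>2 :: laurent fps)"
  have "euler_tail 1 * (fps_const (1 + zpow 1) * qpoch (fps_const (zpow 1)) fps_X *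
       qpoch (fps_const (zpow (-1))) fps_X * euler_tail 1 * Sbar_summand n) =
    zsym 0 * (euler_tail 1)\<^sup>2 * (qpoch (fps_const (zpow 1)) fps_X *
       qpoch (fps_const (zpow (-1))) fps_X * Sbar_summand n)"
    by (simp add: zsym_def power2_eq_square mult_ac)
  also have "\<dots> = fps_X ^ n * R * (zsym 0 * (euler_tail 1)\<^sup>2 * zprod n)"
    unfolding qpoch_mult_Sbar_summand[OF assms] R_def by (simp only: mult_ac)
  \<comment> \<open>Subtracting \<open>zsym 0\<close> is free, since the coefficients add up to
    0.\<close>
  also have "\<dots> = fps_X ^ n * R * (\<Sum>j\<le>n. (zsym j - zsym 0) * jacobi_coeff n j)"
    using sum_jacobi_coeff_eq_0[OF assms, where ?'a = laurent]
    by (simp add: left_diff_distrib sum_subtractf sum_zsym_jacobi_coeff flip: sum_distrib_left)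
  also have "\<dots> = (\<Sum>j\<le>n. (zsym j - zsym 0) * R * (fps_X ^ n * jacobi_coeff n j))"
    by (simp add: sum_distrib_left mult_ac)
  also have "\<dots> = (\<Sum>j\<le>n. (zsym j - zsym 0) * (tri j * fps_X ^ j) *
       ((even_prod n * R) * theta_summand j (n - j)))"
    by (intro sum.cong refl) (simp add: fps_X_power_mult_jacobi_coeff mult_ac)
  finally show ?thesis
    unfolding R_def even_prod_mult_tail .
qed

text \<open>Interchange of summation with \<open>n = j + i\<close>. As \<open>t j i\<close> is
  divisible by \<open>q^(j+i)\<close>, triangle and square of indices give the same sum modulo
  \<open>q^N\<close>.\<close>

lemma qcong_lhs:
  "qcong N (euler_tail 1 * (fps_const (1 + zpow 1) * qpoch (fps_const (zpow 1)) fps_X *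
       qpoch (fps_const (zpow (-1))) fps_X * euler_tail 1 * Sbar))
    (\<Sum>j<N. (zsym j - zsym 0) * (tri j * fps_X ^ j) *
       (qpoch (fps_X\<^sup>2) (fps_X\<^sup>2) * (\<Sum>i<N. theta_summand j i)))"
proof -
  define C where "C = euler_tail 1 * (fps_const (1 + zpow 1) * qpoch (fps_const (zpow 1)) fps_X *
       qpoch (fps_const (zpow (-1))) fps_X * euler_tail 1)"
  define t where "t j i = (zsym j - zsym 0) * (tri j * fps_X ^ j) *
       (qpoch (fps_X\<^sup>2) (fps_X\<^sup>2) * theta_summand j i)" for j i
  have t: "fps_X ^ (j + i) dvd t j i" for j i
    unfolding t_def theta_summand_def power_add by (auto simp: mult_ac)
  have C: "C * Sbar_summand n = (\<Sum>j\<le>n. t j (n - j))" if "n > 0" for n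
    using Sbar_summand_expansion[OF that] by (simp add: C_def t_def mult_ac)
  have "qcong N Sbar (\<Sum>n<N. Sbar_summand (Suc n))"
    unfolding Sbar_def
  proof (rule qcong_suminf)
    fix n
    show "fps_X ^ n dvd Sbar_summand (Suc n)"
      unfolding Sbar_summand_def by (auto intro!: dvd_mult2 le_imp_power_dvd simp del: power_Suc)
  qed
  then have "qcong N (C * Sbar) (C * (\<Sum>n<N. Sbar_summand (Suc n)))"
    by (intro qcong_mult qcong_refl)
  also have "\<dots> = (\<Sum>n<N. \<Sum>j\<le>Suc n. t j (Suc n - j))"
    by (simp only: sum_distrib_left C zero_less_Suc)
  \<comment> \<open>The added term \<open>n = 0\<close> is \<open>t 0 0\<close>, which vanishes
    through \<open>zsym 0 - zsym 0\<close>.\<close>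
  also have "\<dots> = (\<Sum>n<Suc N. \<Sum>j\<le>n. t j (n - j))"
    by (subst sum.lessThan_Suc_shift) (simp add: t_def)
  also have "\<dots> = (\<Sum>(j, i)\<in>{(j, i). j + i < Suc N}. t j i)"
    by (rule sum.triangle_reindex[symmetric])
  \<comment> \<open>The triangle contains \<open>(N, 0)\<close> and \<open>(0, N)\<close>, hence the
    detour through the larger square.\<close>
  also have "qcong N \<dots> (\<Sum>(j, i)\<in>{..<Suc N} \<times> {..<Suc N}. t j i)"
    by (intro qcong_sum_mono_neutral) (auto intro!: qcong_0I[OF t])
  also have "qcong N \<dots> (\<Sum>(j, i)\<in>{..<N} \<times> {..<N}. t j i)"
    by (intro qcong_sym[OF qcong_sum_mono_neutral]) (auto intro!: qcong_0I[OF t])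
  also have "\<dots> = (\<Sum>j<N. (zsym j - zsym 0) * (tri j * fps_X ^ j) *
       (qpoch (fps_X\<^sup>2) (fps_X\<^sup>2) * (\<Sum>i<N. theta_summand j i)))"
    by (simp add: t_def sum_distrib_left mult.assoc flip: sum.cartesian_product)
  finally show ?thesis
    by (simp add: C_def mult_ac)
qed

section \<open>The right-hand side as a Hecke-type double sum\<close>

text \<open>The summand of the right-hand side in the coordinates \<open>j = n - 2|m|\<close> and
  \<open>|m|\<close>.\<close>

definition hecke_term :: "nat \<Rightarrow> nat \<Rightarrow> laurent fps" where
  "hecke_term j m = (zsym j - zsym 0) * (tri j * fps_X ^ j) *
     ((-1) ^ m * fps_X ^ (m\<^sup>2 + m * (2 * j + 1)))"

lemma fps_X_power_dvd_hecke_term: "fps_X ^ (j + 2 * m) dvd hecke_term j m"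
proof -
  have "2 * m \<le> m\<^sup>2 + m * (2 * j + 1)"
    by (cases m) (auto simp: power2_eq_square)
  then have "fps_X ^ j * fps_X ^ (2 * m) dvd
      (fps_X ^ j :: laurent fps) * fps_X ^ (m\<^sup>2 + m * (2 * j + 1))"
    by (intro mult_dvd_mono le_imp_power_dvd) auto
  then have "fps_X ^ (j + 2 * m) dvd
      ((zsym j - zsym 0) * tri j * (-1) ^ m) * (fps_X ^ j * fps_X ^ (m\<^sup>2 + m * (2 * j + 1)))"
    unfolding power_add by (rule dvd_mult)
  then show ?thesis
    by (simp add: hecke_term_def mult_ac)
qed

text \<open>Nonzero \<open>m\<close> come in pairs and 0 is counted once; this produces the shape
  \<open>2 * partial_theta (Suc N) j - 1\<close>.\<close>

lemma sum_symmetric_interval: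
  fixes f :: "nat \<Rightarrow> 'a::comm_ring_1"
  shows "(\<Sum>m\<in>{-int N..int N}. f (nat \<bar>m\<bar>)) = 2 * (\<Sum>m<Suc N. f m) - f 0"
proof (induction N)
  case (Suc N)
  have "{-int (Suc N)..int (Suc N)} = insert (-int (Suc N)) (insert (int (Suc N)) {-int N..int N})"
    by auto
  then have "(\<Sum>m\<in>{-int (Suc N)..int (Suc N)}. f (nat \<bar>m\<bar>)) =
      f (Suc N) + (f (Suc N) + (\<Sum>m\<in>{-int N..int N}. f (nat \<bar>m\<bar>)))"
    by (simp del: of_nat_Suc)
  then show ?case
    using Suc.IH by (simp add: algebra_simps)
qed simp

lemma sum_hecke_term:
  "(\<Sum>m\<in>{-int N..int N}. hecke_term j (nat \<bar>m\<bar>)) =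
     (zsym j - zsym 0) * (tri j * fps_X ^ j) * (2 * partial_theta (Suc N) j - 1)" (is "_ = ?A * _")
proof -
  have "(\<Sum>m<Suc N. hecke_term j m) = ?A * partial_theta (Suc N) j"
    unfolding hecke_term_def partial_theta_def sum_distrib_left ..
  moreover have "hecke_term j 0 = ?A"
    by (simp add: hecke_term_def)
  ultimately show ?thesis
    unfolding sum_symmetric_interval by (simp only: right_diff_distrib mult_1_right mult.left_commute)
qed

lemma rhs_summand_eq:
  assumes m: "2 * nat \<bar>m\<bar> \<le> n"
  shows "(-1) ^ nat (m + int n) *
      fps_const ((1 - zpow (int n - 2 * \<bar>m\<bar> + 1)) * (1 - zpow (int n - 2 * \<bar>m\<bar>)) *
        zpow (2 * \<bar>m\<bar> - int n)) *
      fps_X ^ nat (((int n)\<^sup>2 - 2 * m\<^sup>2 + int n) div 2) =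
    hecke_term (n - 2 * nat \<bar>m\<bar>) (nat \<bar>m\<bar>)"
proof -
  define a where "a = nat \<bar>m\<bar>"
  have a: "\<bar>m\<bar> = int a" "m\<^sup>2 = (int a)\<^sup>2"
    by (simp_all add: a_def)
  obtain j where n: "n = 2 * a + j"
    using m le_Suc_ex unfolding a_def by blast
  have j: "n - 2 * a = j" "int n - 2 * int a = int j" "2 * int a - int n = - int j"
    by (simp_all add: n)
  have sign: "(-1) ^ nat (m + int n) = ((-1) ^ j * (-1) ^ a :: laurent fps)"
  proof -
    \<comment> \<open>For either sign of \<open>m\<close> the exponent, \<open>j + 3a\<close> or
      \<open>j + a\<close>, has the parity of \<open>j + a\<close>.\<close>
    have "m = int a \<or> m = - int a"
      using a(1) by linarith
    then have "nat (m + int n) = j + 3 * a \<or> nat (m + int n) = j + a"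
      using n by auto
    then have "even (nat (m + int n)) \<longleftrightarrow> even (j + a)"
      by auto
    then show ?thesis
      by (simp add: minus_one_power_iff flip: power_add)
  qed
  have "(1 - zpow (int j + 1)) * (1 - zpow (int j)) * zpow (- int j) =
      (zpow (- int j) + zpow (int j + 1)) - (1 + zpow 1)"
    by (simp add: algebra_simps zpow_mult)
  then have z: "fps_const ((1 - zpow (int j + 1)) * (1 - zpow (int j)) * zpow (- int j)) =
      zsym j - zsym 0"
    by (simp add: zsym_def)
  have "int (j choose 2) * 2 = int j * (int j - 1)"
  proof -
    have "(j choose 2) * 2 = j * (j - 1)"
      unfolding choose_two by (rule dvd_div_mult_self) (cases j, auto)
    from arg_cong[OF this, of int] show ?thesis
      by (cases j) (auto simp: algebra_simps)
  qed
  then have "(int n)\<^sup>2 - 2 * (int a)\<^sup>2 + int n =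
      int ((j choose 2) + j + (a\<^sup>2 + a * (2 * j + 1))) * 2"
    by (simp add: n power2_eq_square algebra_simps)
  then have e: "nat (((int n)\<^sup>2 - 2 * (int a)\<^sup>2 + int n) div 2) =
      (j choose 2) + j + (a\<^sup>2 + a * (2 * j + 1))"
    by (metis nat_int nonzero_mult_div_cancel_right zero_neq_numeral)
  show ?thesis
    unfolding a nat_int j sign z e hecke_term_def tri_def power_add
    by (simp only: mult_ac)
qed

lemma rhs_inner_sum_eq:
  "(\<Sum>m\<in>{-\<lfloor>real n / 2\<rfloor>..\<lfloor>real n / 2\<rfloor>}.
      (-1) ^ nat (m + int n) *
      fps_const ((1 - zpow (int n - 2 * \<bar>m\<bar> + 1)) * (1 - zpow (int n - 2 * \<bar>m\<bar>)) *
        zpow (2 * \<bar>m\<bar> - int n)) *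
      fps_X ^ nat (((int n)\<^sup>2 - 2 * m\<^sup>2 + int n) div 2)) =
    (\<Sum>m | 2 * nat \<bar>m\<bar> \<le> n. hecke_term (n - 2 * nat \<bar>m\<bar>) (nat \<bar>m\<bar>))"
proof (rule sum.cong)
  show "{-\<lfloor>real n / 2\<rfloor>..\<lfloor>real n / 2\<rfloor>} = {m. 2 * nat \<bar>m\<bar> \<le> n}"
    using floor_divide_of_nat_eq[of n 2, where ?'a = real] by auto
qed (simp add: rhs_summand_eq)

text \<open>Reindexing by \<open>(n, m) \<mapsto> (n - 2|m|, m)\<close> gives the region
  \<open>j + 2|m| < N\<close>; it extends to a rectangle because the added terms are divisible by
  \<open>q^N\<close>.\<close>

lemma qcong_rhs:
  "qcong N (suminf (\<lambda>n. \<Sum>m | 2 * nat \<bar>m\<bar> \<le> n. hecke_term (n - 2 * nat \<bar>m\<bar>) (nat \<bar>m\<bar>)))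
    (\<Sum>j<N. \<Sum>m\<in>{-int N..int N}. hecke_term j (nat \<bar>m\<bar>))"
proof -
  define S :: "nat \<Rightarrow> int set" where "S n = {m. 2 * nat \<bar>m\<bar> \<le> n}" for n
  have "S n \<subseteq> {-int n..int n}" for n
    by (auto simp: S_def)
  then have fin: "finite (S n)" for n
    by (rule finite_subset) simp
  define T where "T = {(j, m::int). j + 2 * nat \<bar>m\<bar> < N}"
  have "qcong N (suminf (\<lambda>n. \<Sum>m\<in>S n. hecke_term (n - 2 * nat \<bar>m\<bar>) (nat \<bar>m\<bar>)))
      (\<Sum>n<N. \<Sum>m\<in>S n. hecke_term (n - 2 * nat \<bar>m\<bar>) (nat \<bar>m\<bar>))"
  proof (rule qcong_suminf, rule dvd_sum)
    fix n m assume "m \<in> S n"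
    then show "fps_X ^ n dvd hecke_term (n - 2 * nat \<bar>m\<bar>) (nat \<bar>m\<bar>)"
      using fps_X_power_dvd_hecke_term[of "n - 2 * nat \<bar>m\<bar>" "nat \<bar>m\<bar>"] by (simp add: S_def)
  qed
  also have "(\<Sum>n<N. \<Sum>m\<in>S n. hecke_term (n - 2 * nat \<bar>m\<bar>) (nat \<bar>m\<bar>)) =
      (\<Sum>(n, m)\<in>Sigma {..<N} S. hecke_term (n - 2 * nat \<bar>m\<bar>) (nat \<bar>m\<bar>))"
    by (rule sum.Sigma) (auto simp: fin)
  also have "\<dots> = (\<Sum>(j, m)\<in>T. hecke_term j (nat \<bar>m\<bar>))"
    by (rule sum.reindex_bij_witness[of _ "\<lambda>(j, m). (j + 2 * nat \<bar>m\<bar>, m)"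
          "\<lambda>(n, m). (n - 2 * nat \<bar>m\<bar>, m)"]) (auto simp: S_def T_def)
  also have "qcong N \<dots> (\<Sum>(j, m)\<in>{..<N} \<times> {-int N..int N}. hecke_term j (nat \<bar>m\<bar>))"
    by (rule qcong_sum_mono_neutral)
      (auto simp: T_def intro!: qcong_0I[OF fps_X_power_dvd_hecke_term])
  finally show ?thesis
    by (simp add: S_def sum.cartesian_product)
qed

section \<open>Comparison of the two sides\<close>

theorem theorem6p1:
  shows "fps_const (1 + zpow 1) * qpoch (fps_const (zpow 1)) fps_X *
           qpoch (fps_const (zpow (-1))) fps_X * qpoch fps_X fps_X * Sbar =
         suminf (\<lambda>n::nat. \<Sum>m\<in>{-\<lfloor>real n / 2\<rfloor>..\<lfloor>real n / 2\<rfloor>}.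
            (-1) ^ nat (m + int n) *
            fps_const ((1 - zpow (int n - 2 * \<bar>m\<bar> + 1)) * (1 - zpow (int n - 2 * \<bar>m\<bar>)) *
                       zpow (2 * \<bar>m\<bar> - int n)) *
            fps_X ^ nat (((int n)\<^sup>2 - 2 * m\<^sup>2 + int n) div 2))"
    (is "?L = ?R")
proof -
  have E1: "qpoch fps_X fps_X = (euler_tail 1 :: laurent fps)"
    by (simp add: euler_tail_def)
  have "euler_tail 1 * ?L = euler_tail 1 * ?R"
  proof (rule qcong_eqI)
    fix N
    have "qcong N (euler_tail 1 * ?L) (\<Sum>j<N. (zsym j - zsym 0) * (tri j * fps_X ^ j) *
        (qpoch (fps_X\<^sup>2) (fps_X\<^sup>2) * (\<Sum>i<N. theta_summand j i)))"
      unfolding E1 by (rule qcong_lhs)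
    also have "qcong N \<dots> (\<Sum>j<N. (zsym j - zsym 0) * (tri j * fps_X ^ j) *
        (euler_tail 1 * (2 * partial_theta (Suc N) j - 1)))"
      by (intro qcong_sum qcong_mult qcong_refl qcong_theta_sum)
    also have "\<dots> = euler_tail 1 * (\<Sum>j<N. \<Sum>m\<in>{-int N..int N}. hecke_term j (nat \<bar>m\<bar>))"
      by (simp add: sum_hecke_term sum_distrib_left mult_ac)
    also have "qcong N \<dots> (euler_tail 1 * ?R)"
      unfolding rhs_inner_sum_eq by (intro qcong_mult qcong_refl qcong_sym[OF qcong_rhs])
    finally show "qcong N (euler_tail 1 * ?L) (euler_tail 1 * ?R)" .
  qed
  \<comment> \<open>The auxiliary factor has constant coefficient 1, so it cancels in the integral
    domain.\<close>
  moreover have "euler_tail 1 \<noteq> (0 :: laurent fps)"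
    using qcong_euler_tail[of 1 1, where ?'a = laurent] by (auto simp: qcong_def)
  ultimately show ?thesis
    by simp
qed

end
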